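(* Let $\mathbf{A}=(A;\wedge,\vee,\neg,\top)$ be a centered Kleene algebra with center $\top$, and put $\Diamond x:=x\wedge\top$ and $\Diamond(\mathbf{A}):=(\Diamond[A];\wedge,\vee,\top)$. Then $\mathbf{A}$ is isomorphic to a DF-twist-algebra over $\Diamond(\mathbf{A})$ via the map $\iota\colon\mathbf{A}\to\Diamond(\mathbf{A})\times\Diamond(\mathbf{A})$, $a\mapsto(\Diamond a,\Diamond\neg a)$.
   Context: A De Morgan lattice is a distributive lattice with a unary operation $\neg$ satisfying $\neg\neg a=a$ and $\neg(a\wedge b)=\neg a\vee\neg b$. A Kleene algebra is a De Morgan lattice (not necessarily bounded) satisfying $\neg a\wedge a\le\neg b\vee b$ for all $a,b$. It is centered if it has an element $\top$ with $\neg\top=\top$ (necessarily unique), which is included in the signature as a constant. $\Diamond(\mathbf{A})$ carries the operations of $\mathbf{A}$ restricted to $\Diamond[A]=\{a\wedge\top:a\in A\}$; it is a distributive lattice with greatest element $\top$. Let $\mathbf{L}=(L;\wedge,\vee,1)$ be a distributive lattice with greatest element $1$. The full DF-twist-algebra $\mathbf{L}^{\bowtie}$ has universe $\{(a_1,a_2)\in L\times L: a_1\vee a_2=1\}$ and operations $(x_1,x_2)\wedge(y_1,y_2):=(x_1\wedge y_1,x_2\vee y_2)$, $\neg(x_1,x_2):=(x_2,x_1)$, $\top:=(1,1)$, with $x\vee y:=\neg(\neg x\wedge\neg y)$. A DF-twist-algebra over $\mathbf{L}$ is any subalgebra $\mathbf{C}\leqslant\mathbf{L}^{\bowtie}$ such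 that $\pi_1[C]=L$, where $\pi_1$ is the first projection. *)

theory Defs
  imports "HOL-Algebra.Congruence"
begin

record 'a lattice_alg = "'a partial_object" +
  meet :: "'a \<Rightarrow> 'a \<Rightarrow> 'a" (infixl "\<sqinter>\<index>" 70)
  join :: "'a \<Rightarrow> 'a \<Rightarrow> 'a" (infixl "\<squnion>\<index>" 65)

record 'a top_lattice_alg = "'a lattice_alg" +
  top_elem :: 'a ("\<one>\<index>")

record 'a neg_lattice_alg = "'a lattice_alg" +
  neg :: "'a \<Rightarrow> 'a" ("\<ominus>\<index> _" [81] 80)

record 'a centered_alg = "'a neg_lattice_alg" +
  center :: 'a ("\<top>\<index>")

definition latt_le :: "_ \<Rightarrow> 'a \<Rightarrow> 'a \<Rightarrow> bool" (infix "\<sqsubseteq>\<index>" 50)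
  where "x \<sqsubseteq>\<^bsub>L\<^esub> y \<longleftrightarrow> x \<sqinter>\<^bsub>L\<^esub> y = x"

locale distributive_lattice =
  fixes L :: "('a, 'm) lattice_alg_scheme" (structure)
  assumes meet_closed: "\<lbrakk>x \<in> carrier L; y \<in> carrier L\<rbrakk> \<Longrightarrow> x \<sqinter> y \<in> carrier L"
    and join_closed: "\<lbrakk>x \<in> carrier L; y \<in> carrier L\<rbrakk> \<Longrightarrow> x \<squnion> y \<in> carrier L"
    and meet_comm: "\<lbrakk>x \<in> carrier L; y \<in> carrier L\<rbrakk> \<Longrightarrow> x \<sqinter> y = y \<sqinter> x"
    and join_comm: "\<lbrakk>x \<in> carrier L; y \<in> carrier L\<rbrakk> \<Longrightarrow> x \<squnion> y = y \<squnion> x"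
    and meet_assoc: "\<lbrakk>x \<in> carrier L; y \<in> carrier L; z \<in> carrier L\<rbrakk>
          \<Longrightarrow> (x \<sqinter> y) \<sqinter> z = x \<sqinter> (y \<sqinter> z)"
    and join_assoc: "\<lbrakk>x \<in> carrier L; y \<in> carrier L; z \<in> carrier L\<rbrakk>
          \<Longrightarrow> (x \<squnion> y) \<squnion> z = x \<squnion> (y \<squnion> z)"
    and meet_join_absorb: "\<lbrakk>x \<in> carrier L; y \<in> carrier L\<rbrakk> \<Longrightarrow> x \<sqinter> (x \<squnion> y) = x"
    and join_meet_absorb: "\<lbrakk>x \<in> carrier L; y \<in> carrier L\<rbrakk> \<Longrightarrow> x \<squnion> (x \<sqinter> y) = x"
    and meet_join_distrib: "\<lbrakk>x \<in> carrier L; y \<in> carrier L; z \<in> carrier L\<rbrakk>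
          \<Longrightarrow> x \<sqinter> (y \<squnion> z) = (x \<sqinter> y) \<squnion> (x \<sqinter> z)"

locale distributive_lattice_top = distributive_lattice L
  for L :: "('a, 'm) top_lattice_alg_scheme" (structure) +
  assumes top_closed: "\<one> \<in> carrier L"
    and top_greatest: "x \<in> carrier L \<Longrightarrow> x \<sqsubseteq> \<one>"

locale de_morgan_lattice = distributive_lattice A
  for A :: "('a, 'm) neg_lattice_alg_scheme" (structure) +
  assumes neg_closed: "x \<in> carrier A \<Longrightarrow> \<ominus> x \<in> carrier A"
    and neg_neg: "x \<in> carrier A \<Longrightarrow> \<ominus> (\<ominus> x) = x"
    and neg_meet: "\<lbrakk>x \<in> carrier A; y \<in> carrier A\<rbrakk> \<Longrightarrow> \<ominus> (x \<sqinter> y) = (\<ominus> x) \<squnion> (\<ominus> y)"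

locale kleene_algebra = de_morgan_lattice A
  for A :: "('a, 'm) neg_lattice_alg_scheme" (structure) +
  assumes kleene: "\<lbrakk>x \<in> carrier A; y \<in> carrier A\<rbrakk>
    \<Longrightarrow> (\<ominus> x) \<sqinter> x \<sqsubseteq> (\<ominus> y) \<squnion> y"

locale centered_kleene_algebra = kleene_algebra A
  for A :: "('a, 'm) centered_alg_scheme" (structure) +
  assumes center_closed: "\<top> \<in> carrier A"
    and neg_center: "\<ominus> \<top> = \<top>"

definition dia :: "('a, 'm) centered_alg_scheme \<Rightarrow> 'a \<Rightarrow> 'a"
  where "dia A x = x \<sqinter>\<^bsub>A\<^esub> \<top>\<^bsub>A\<^esub>"

definition Dia :: "('a, 'm) centered_alg_scheme \<Rightarrow> 'a top_lattice_alg"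
  where "Dia A = \<lparr>carrier = dia A ` carrier A, meet = meet A, join = join A, top_elem = center A\<rparr>"

definition twist_meet :: "('a, 'm) lattice_alg_scheme \<Rightarrow> 'a \<times> 'a \<Rightarrow> 'a \<times> 'a \<Rightarrow> 'a \<times> 'a"
  where "twist_meet L x y = (fst x \<sqinter>\<^bsub>L\<^esub> fst y, snd x \<squnion>\<^bsub>L\<^esub> snd y)"

definition full_DF_twist :: "('a, 'm) top_lattice_alg_scheme \<Rightarrow> ('a \<times> 'a) centered_alg"
  where "full_DF_twist L =
    \<lparr>carrier = {(a, b). a \<in> carrier L \<and> b \<in> carrier L \<and> a \<squnion>\<^bsub>L\<^esub> b = \<one>\<^bsub>L\<^esub>},
     meet = twist_meet L,
     join = (\<lambda>x y. prod.swap (twist_meet L (prod.swap x) (prod.swap y))),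
     neg = prod.swap,
     center = (\<one>\<^bsub>L\<^esub>, \<one>\<^bsub>L\<^esub>)\<rparr>"

definition subalgebra :: "('a, 'm) centered_alg_scheme \<Rightarrow> ('a, 'n) centered_alg_scheme \<Rightarrow> bool"
  where "subalgebra C B \<longleftrightarrow>
    carrier C \<subseteq> carrier B \<and>
    \<top>\<^bsub>C\<^esub> = \<top>\<^bsub>B\<^esub> \<and> \<top>\<^bsub>B\<^esub> \<in> carrier C \<and>
    (\<forall>x \<in> carrier C. \<ominus>\<^bsub>C\<^esub> x = \<ominus>\<^bsub>B\<^esub> x \<and> \<ominus>\<^bsub>B\<^esub> x \<in> carrier C) \<and>
    (\<forall>x \<in> carrier C. \<forall>y \<in> carrier C.
      x \<sqinter>\<^bsub>C\<^esub> y = x \<sqinter>\<^bsub>B\<^esub> y \<and> x \<sqinter>\<^bsub>B\<^esub> y \<in> carrier C \<and>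
      x \<squnion>\<^bsub>C\<^esub> y = x \<squnion>\<^bsub>B\<^esub> y \<and> x \<squnion>\<^bsub>B\<^esub> y \<in> carrier C)"

definition DF_twist_algebra_over ::
    "('a, 'm) top_lattice_alg_scheme \<Rightarrow> ('a \<times> 'a, 'n) centered_alg_scheme \<Rightarrow> bool"
  where "DF_twist_algebra_over L C \<longleftrightarrow>
    distributive_lattice_top L \<and> subalgebra C (full_DF_twist L) \<and> fst ` carrier C = carrier L"

definition centered_iso ::
    "('a, 'm) centered_alg_scheme \<Rightarrow> ('b, 'n) centered_alg_scheme \<Rightarrow> ('a \<Rightarrow> 'b) \<Rightarrow> bool"
  where "centered_iso A B h \<longleftrightarrow>
    bij_betw h (carrier A) (carrier B) \<and>
    h \<top>\<^bsub>A\<^esub> = \<top>\<^bsub>B\<^esub> \<and>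
    (\<forall>x \<in> carrier A. h (\<ominus>\<^bsub>A\<^esub> x) = \<ominus>\<^bsub>B\<^esub> (h x)) \<and>
    (\<forall>x \<in> carrier A. \<forall>y \<in> carrier A.
      h (x \<sqinter>\<^bsub>A\<^esub> y) = h x \<sqinter>\<^bsub>B\<^esub> h y \<and> h (x \<squnion>\<^bsub>A\<^esub> y) = h x \<squnion>\<^bsub>B\<^esub> h y)"

definition twist_map :: "('a, 'm) centered_alg_scheme \<Rightarrow> 'a \<Rightarrow> 'a \<times> 'a"
  where "twist_map A a = (dia A a, dia A (\<ominus>\<^bsub>A\<^esub> a))"

end

theory Submission
  imports Defs
begin

text \<open>
  Truncation at the center, \<open>a \<mapsto> a \<sqinter> \<top>\<close>, preserves meets in any lattice, and joins because the
  lattice is distributive. By De Morgan, \<open>\<ominus>\<close> exchanges meets and joins, so truncating \<open>\<ominus> a\<close>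
  turns the operations of the second coordinate upside down; this is exactly how the twist
  operations are defined, and hence \<open>a \<mapsto> (a \<sqinter> \<top>, \<ominus> a \<sqinter> \<top>)\<close> respects all operations.
  Two points remain.

  The pair lies in the full twist-algebra: this is where the Kleene inequality enters. Since the
  center is its own negation, \<open>\<top> = \<ominus> \<top> \<sqinter> \<top>\<close> lies below every \<open>\<ominus> a \<squnion> a\<close> (lemma
  \<open>center_le_neg_join\<close>), so the two truncations join to \<open>\<top>\<close>.

  The map is injective: negating \<open>\<ominus> a \<sqinter> \<top>\<close> gives \<open>a \<squnion> \<top>\<close>, so the pair determines both
  \<open>a \<sqinter> \<top>\<close> and \<open>a \<squnion> \<top>\<close>, and in a distributive lattice these two determine \<open>a\<close> (lemma
  \<open>meet_join_cancel\<close>).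

  The required subalgebra is then the image of the map; its first projection is onto because
  the first coordinate is the truncation itself.
\<close>

context distributive_lattice
begin

lemma meet_idem:
  assumes "x \<in> carrier L"
  shows "x \<sqinter> x = x"
  using assms by (metis join_meet_absorb meet_closed meet_join_absorb)

lemma join_meet_distrib_right:
  assumes "x \<in> carrier L" "y \<in> carrier L" "t \<in> carrier L"
  shows "(x \<squnion> y) \<sqinter> t = (x \<sqinter> t) \<squnion> (y \<sqinter> t)"
  using assms by (metis join_closed meet_comm meet_join_distrib)

lemma meet_meet_distrib_right:
  assumes "x \<in> carrier L" "y \<in> carrier L" "t \<in> carrier L"
  shows "(x \<sqinter> y) \<sqinter> t = (x \<sqinter> t) \<sqinter> (y \<sqinter> t)"
  using assms by (metis meet_assoc meet_closed meet_comm meet_idem)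

text \<open>
  The cancellation law characteristic of distributivity. By absorption and the join hypothesis
  \<open>x = x \<sqinter> (y \<squnion> t)\<close>; distributing this and using the meet hypothesis gives
  \<open>(x \<sqinter> y) \<squnion> (y \<sqinter> t)\<close>, and factoring out \<open>y\<close> instead of \<open>x\<close> reverses the computation to end
  at \<open>y\<close>.
\<close>

lemma meet_join_cancel:
  assumes x: "x \<in> carrier L" and y: "y \<in> carrier L" and t: "t \<in> carrier L"
    and meet_eq: "x \<sqinter> t = y \<sqinter> t" and join_eq: "x \<squnion> t = y \<squnion> t"
  shows "x = y"
proof -
  have "x = x \<sqinter> (y \<squnion> t)"
    using meet_join_absorb[OF x t] join_eq by simp
  also have "\<dots> = (x \<sqinter> y) \<squnion> (x \<sqinter> t)"
    by (rule meet_join_distrib[OF x y t])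
  also have "\<dots> = (y \<sqinter> x) \<squnion> (y \<sqinter> t)"
    using meet_eq meet_comm[OF x y] by simp
  also have "\<dots> = y \<sqinter> (x \<squnion> t)"
    by (rule meet_join_distrib[OF y x t, symmetric])
  also have "\<dots> = y"
    using meet_join_absorb[OF y t] join_eq by simp
  finally show ?thesis .
qed

end

lemma (in de_morgan_lattice) neg_join:
  assumes "x \<in> carrier A" "y \<in> carrier A"
  shows "\<ominus> (x \<squnion> y) = (\<ominus> x) \<sqinter> (\<ominus> y)"
  using assms by (metis meet_closed neg_closed neg_meet neg_neg)

context centered_kleene_algebra
begin

lemma dia_closed: "x \<in> carrier A \<Longrightarrow> dia A x \<in> carrier A"
  unfolding dia_def using meet_closed center_closed by blast

lemma dia_center: "dia A \<top> = \<top>"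
  unfolding dia_def using meet_idem center_closed by blast

lemma dia_meet:
  assumes "x \<in> carrier A" "y \<in> carrier A"
  shows "dia A (x \<sqinter> y) = dia A x \<sqinter> dia A y"
  unfolding dia_def using assms center_closed by (rule meet_meet_distrib_right)

lemma dia_join:
  assumes "x \<in> carrier A" "y \<in> carrier A"
  shows "dia A (x \<squnion> y) = dia A x \<squnion> dia A y"
  unfolding dia_def using assms center_closed by (rule join_meet_distrib_right)

text \<open>
  The range of truncation is closed under both operations because truncation preserves them, so
  it inherits the lattice laws from the whole algebra.
\<close>

lemma Dia_distributive_lattice_top: "distributive_lattice_top (Dia A)"
proof
  show "x \<sqinter>\<^bsub>Dia A\<^esub> y \<in> carrier (Dia A)" "x \<squnion>\<^bsub>Dia A\<^esub> y \<in> carrier (Dia A)"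
    if "x \<in> carrier (Dia A)" "y \<in> carrier (Dia A)" for x y
    using that
    by (auto simp: Dia_def meet_closed join_closed simp flip: dia_meet dia_join)
  show "\<one>\<^bsub>Dia A\<^esub> \<in> carrier (Dia A)"
    using dia_center center_closed by (force simp: Dia_def)
  show "x \<sqsubseteq>\<^bsub>Dia A\<^esub> \<one>\<^bsub>Dia A\<^esub>" if "x \<in> carrier (Dia A)" for x
    using that by (auto simp: Dia_def latt_le_def dia_def meet_assoc meet_idem center_closed)
qed (auto simp: Dia_def dia_closed
       intro: meet_comm join_comm meet_assoc join_assoc meet_join_absorb join_meet_absorb
         meet_join_distrib)

text \<open>The Kleene inequality for the pair \<open>\<top>, a\<close>, in which \<open>\<ominus> \<top> \<sqinter> \<top>\<close> collapses to \<open>\<top>\<close>.\<close>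

lemma center_le_neg_join:
  assumes "a \<in> carrier A"
  shows "\<top> \<sqsubseteq> (\<ominus> a) \<squnion> a"
  using kleene[OF center_closed assms] by (simp add: neg_center meet_idem center_closed)

lemma dia_join_dia_neg:
  assumes "a \<in> carrier A"
  shows "dia A a \<squnion> dia A (\<ominus> a) = \<top>"
proof -
  have "dia A a \<squnion> dia A (\<ominus> a) = (a \<squnion> \<ominus> a) \<sqinter> \<top>"
    using dia_join assms neg_closed by (simp add: dia_def)
  also have "\<dots> = \<top> \<sqinter> ((\<ominus> a) \<squnion> a)"
    using assms by (simp add: join_comm meet_comm join_closed neg_closed center_closed)
  also have "\<dots> = \<top>"
    using center_le_neg_join[OF assms] by (simp add: latt_le_def)
  finally show ?thesis .
qed

lemma twist_map_closed:
  assumes "a \<in> carrier A"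
  shows "twist_map A a \<in> carrier (full_DF_twist (Dia A))"
  using assms by (simp add: twist_map_def full_DF_twist_def Dia_def neg_closed dia_join_dia_neg)

text \<open>
  The second coordinates agree precisely when the joins with \<open>\<top>\<close> do, since
  \<open>\<ominus> (\<ominus> a \<sqinter> \<top>) = a \<squnion> \<top>\<close>; cancellation then applies.
\<close>

lemma inj_on_twist_map: "inj_on (twist_map A) (carrier A)"
proof (rule inj_onI)
  fix a b
  assume a: "a \<in> carrier A" and b: "b \<in> carrier A" and eq: "twist_map A a = twist_map A b"
  have neg_dia_neg: "\<ominus> (dia A (\<ominus> x)) = x \<squnion> \<top>" if "x \<in> carrier A" for x
    using that by (simp add: dia_def neg_meet neg_closed neg_neg neg_center center_closed)
  have "a \<sqinter> \<top> = b \<sqinter> \<top>"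
    using eq by (simp add: twist_map_def dia_def)
  moreover have "a \<squnion> \<top> = b \<squnion> \<top>"
    using eq neg_dia_neg[OF a] neg_dia_neg[OF b] by (simp add: twist_map_def)
  ultimately show "a = b"
    using meet_join_cancel[OF a b center_closed] by blast
qed

lemma twist_map_center: "twist_map A \<top> = \<top>\<^bsub>full_DF_twist (Dia A)\<^esub>"
  by (simp add: twist_map_def full_DF_twist_def Dia_def neg_center dia_center)

lemma twist_map_neg:
  assumes "a \<in> carrier A"
  shows "twist_map A (\<ominus> a) = \<ominus>\<^bsub>full_DF_twist (Dia A)\<^esub> (twist_map A a)"
  using assms by (simp add: twist_map_def full_DF_twist_def neg_neg)

lemma twist_map_meet:
  assumes "a \<in> carrier A" "b \<in> carrier A"
  shows "twist_map A (a \<sqinter> b) = twist_map A a \<sqinter>\<^bsub>full_DF_twist (Dia A)\<^esub> twist_map A b"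
  using assms
  by (simp add: twist_map_def full_DF_twist_def twist_meet_def Dia_def
      neg_closed neg_meet dia_meet dia_join)

lemma twist_map_join:
  assumes "a \<in> carrier A" "b \<in> carrier A"
  shows "twist_map A (a \<squnion> b) = twist_map A a \<squnion>\<^bsub>full_DF_twist (Dia A)\<^esub> twist_map A b"
  using assms
  by (simp add: twist_map_def full_DF_twist_def twist_meet_def Dia_def
      neg_closed neg_join dia_meet dia_join)

end

theorem theorem29:
  fixes A :: "'a centered_alg"
  assumes "centered_kleene_algebra A"
  shows "\<exists>C :: ('a \<times> 'a) centered_alg.
    DF_twist_algebra_over (Dia A) C \<and> centered_iso A C (twist_map A)"
proof -
  interpret centered_kleene_algebra A by (rule assms)
  let ?T = "full_DF_twist (Dia A)"
  define C where "C = ?T\<lparr>carrier := twist_map A ` carrier A\<rparr>"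
  have carrier_C: "carrier C = twist_map A ` carrier A"
    and ops_C: "meet C = meet ?T" "join C = join ?T" "neg C = neg ?T" "center C = center ?T"
    by (simp_all add: C_def)
  \<comment> \<open>The image of a homomorphism is closed under the operations of its target.\<close>
  have "subalgebra C ?T"
    unfolding subalgebra_def carrier_C ops_C
    using twist_map_closed center_closed neg_closed meet_closed join_closed
    by (auto simp flip: twist_map_center twist_map_neg twist_map_meet twist_map_join)
  moreover have "fst ` carrier C = carrier (Dia A)"
    by (simp add: carrier_C Dia_def image_image twist_map_def)
  ultimately have "DF_twist_algebra_over (Dia A) C"
    unfolding DF_twist_algebra_over_def using Dia_distributive_lattice_top by blast
  moreover have "centered_iso A C (twist_map A)"
    unfolding centered_iso_def ops_C bij_betw_def carrier_C
    using inj_on_twist_map twist_map_center twist_map_neg twist_map_meet twist_map_join by blast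
  ultimately show ?thesis by blast
qed

end
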